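(* Let $G$ be a finite simple undirected graph, let $k,s$ be positive integers, let $D^k[G]$ be the $k$-fold graph of $G$, and let $G\otimes sK_2$ denote the iterated Kronecker product $G\otimes K_2\otimes K_2\otimes\cdots\otimes K_2$ with $s$ factors $K_2$. Then $D^k[G]$ and $G\otimes sK_2$ are non-cospectral equienergetic graphs if and only if $k=2^s$.
   Context: The $A$-spectrum of a graph is the multiset of eigenvalues $\lambda_1,\dots,\lambda_n$ of its adjacency matrix, and its energy is $E(G)=\sum_{i=1}^n|\lambda_i|$. Two graphs of the same order are equienergetic if they have equal energy; they are non-cospectral if their $A$-spectra differ. The $k$-fold graph $D^k[G]$ is obtained by taking $k$ copies of $G$ and joining each vertex in one copy with the neighbours of the corresponding vertices in the other copies; i.e. it has vertex set $V(G)\times\{1,\dots,k\}$ with $(u,a)$ adjacent to $(v,b)$ iff $u$ is adjacent to $v$ in $G$. The Kronecker product $G_1\otimes G_2$ has vertex set $V(G_1)\times V(G_2)$, with $(u_1,v_1)$ adjacent to $(u_2,v_2)$ iff $u_1u_2$ is an edge of $G_1$ and $v_1v_2$ is an edge of $G_2$.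
   Formalization: The graph G is additionally assumed to have at least one edge; for edgeless G and k = 2^s both graphs are edgeless of the same order, hence cospectral, so the claim as stated fails. *)

theory Defs
  imports
    "Graph_Theory.Pair_Digraph"
    "Jordan_Normal_Form.Char_Poly"
    "HOL-Computational_Algebra.Fundamental_Theorem_Algebra"
begin

text \<open>
  A finite simple undirected graph is a \<^locale>\<open>pair_graph\<close>: a finite symmetric loop-free
  relation \<^const>\<open>parcs\<close> on the vertex set \<^const>\<open>pverts\<close>. Each undirected edge is
  represented by its two arcs.
\<close>

subsection \<open>Spectrum and energy\<close>

definition adj_mat :: "'a pair_pre_digraph \<Rightarrow> 'a list \<Rightarrow> complex mat" where
  "adj_mat G vs = mat (length vs) (length vs)
     (\<lambda>(i, j). if (vs ! i, vs ! j) \<in> parcs G then 1 else 0)"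

text \<open>
  The matrix depends on an enumeration of the vertices, the spectrum does not: see
  \<open>graph_spectrum_eq\<close> below. Taking the entries in the complex numbers guarantees that
  \<^const>\<open>proots\<close> yields all eigenvalues with multiplicity; they are real because the matrix
  is symmetric, so the modulus in \<open>energy\<close> is the absolute value.
\<close>

definition graph_spectrum :: "'a pair_pre_digraph \<Rightarrow> complex multiset" where
  "graph_spectrum G =
     proots (char_poly (adj_mat G (SOME vs. distinct vs \<and> set vs = pverts G)))"

definition energy :: "'a pair_pre_digraph \<Rightarrow> real" where
  "energy G = (\<Sum>x\<in>#graph_spectrum G. cmod x)"

definition equienergetic :: "'a pair_pre_digraph \<Rightarrow> 'b pair_pre_digraph \<Rightarrow> bool" where
  "equienergetic G H \<longleftrightarrow> card (pverts G) = card (pverts H) \<and> energy G = energy H"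

definition non_cospectral :: "'a pair_pre_digraph \<Rightarrow> 'b pair_pre_digraph \<Rightarrow> bool" where
  "non_cospectral G H \<longleftrightarrow> graph_spectrum G \<noteq> graph_spectrum H"

lemma char_poly_adj_mat_perm:
  assumes "distinct vs" "distinct ws" "set vs = set ws"
  shows "char_poly (adj_mat G vs) = char_poly (adj_mat G ws)"
proof -
  define n where "n = length vs"
  have lw: "length ws = n"
    using assms unfolding n_def by (metis distinct_card)
  define P :: "complex mat" where "P = mat n n (\<lambda>(i, j). if vs ! i = ws ! j then 1 else 0)"
  define Q :: "complex mat" where "Q = mat n n (\<lambda>(i, j). if ws ! i = vs ! j then 1 else 0)"
  have sv: "\<exists>!k. k < n \<and> x = vs ! k" if "x \<in> set vs" for x
    using that assms(1) unfolding n_def by (metis in_set_conv_nth nth_eq_iff_index_eq)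
  have sw: "\<exists>!k. k < n \<and> x = ws ! k" if "x \<in> set vs" for x
    using that assms(2,3) lw by (metis in_set_conv_nth nth_eq_iff_index_eq)
  have sumv: "(\<Sum>k\<in>{0..<n}. (if x = vs ! k then 1 else 0) * f (vs ! k)) = f x"
    if x: "x \<in> set vs" for x and f :: "'a \<Rightarrow> complex"
  proof -
    obtain k where k: "k < n" "x = vs ! k" "\<And>j. j < n \<Longrightarrow> x = vs ! j \<Longrightarrow> j = k"
      by (rule ex1E[OF sv[OF x]]) blast
    have "(if x = vs ! j then 1 else 0) * f (vs ! j) = (if j = k then f x else 0)"
      if "j < n" for j
    proof (cases "j = k")
      case True
      then show ?thesis by (simp flip: k(2))
    next
      case False
      then have "x \<noteq> vs ! j" using k(3)[OF that] by blast
      then show ?thesis using False by simp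
    qed
    then have "(\<Sum>j\<in>{0..<n}. (if x = vs ! j then 1 else 0) * f (vs ! j))
        = (\<Sum>j\<in>{0..<n}. if j = k then f x else 0)"
      by (intro sum.cong refl) simp
    then show ?thesis using k(1) by simp
  qed
  have sumw: "(\<Sum>k\<in>{0..<n}. (if x = ws ! k then 1 else 0) * f (ws ! k)) = f x"
    if x: "x \<in> set vs" for x and f :: "'a \<Rightarrow> complex"
  proof -
    obtain k where k: "k < n" "x = ws ! k" "\<And>j. j < n \<Longrightarrow> x = ws ! j \<Longrightarrow> j = k"
      by (rule ex1E[OF sw[OF x]]) blast
    have "(if x = ws ! j then 1 else 0) * f (ws ! j) = (if j = k then f x else 0)"
      if "j < n" for j
    proof (cases "j = k")
      case True
      then show ?thesis by (simp flip: k(2))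
    next
      case False
      then have "x \<noteq> ws ! j" using k(3)[OF that] by blast
      then show ?thesis using False by simp
    qed
    then have "(\<Sum>j\<in>{0..<n}. (if x = ws ! j then 1 else 0) * f (ws ! j))
        = (\<Sum>j\<in>{0..<n}. if j = k then f x else 0)"
      by (intro sum.cong refl) simp
    then show ?thesis using k(1) by simp
  qed
  have mv: "vs ! i \<in> set vs" "ws ! i \<in> set vs" if "i < n" for i
    using that lw assms(3) nth_mem[of i vs] nth_mem[of i ws] unfolding n_def by simp_all
  have PQ: "P * Q = 1\<^sub>m n"
  proof (rule eq_matI)
    fix i j assume "i < dim_row (1\<^sub>m n)" "j < dim_col (1\<^sub>m n)"
    then have ij: "i < n" "j < n" by auto
    have "(P * Q) $$ (i, j) = (\<Sum>k\<in>{0..<n}. (if vs ! i = ws ! k then 1 else 0) *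
            (if ws ! k = vs ! j then 1 else 0))"
      using ij by (simp add: P_def Q_def scalar_prod_def)
    also have "\<dots> = (if vs ! i = vs ! j then 1 else 0)"
      using sumw[OF mv(1)[OF ij(1)], of "\<lambda>y. if y = vs ! j then 1 else 0"] .
    finally show "(P * Q) $$ (i, j) = 1\<^sub>m n $$ (i, j)"
      using ij assms(1) by (simp add: n_def nth_eq_iff_index_eq)
  qed (auto simp: P_def Q_def)
  have QP: "Q * P = 1\<^sub>m n"
    using mat_mult_left_right_inverse[OF _ _ PQ] by (simp add: P_def Q_def)
  have comm: "adj_mat G vs * P = P * adj_mat G ws"
  proof (rule eq_matI)
    fix i j assume "i < dim_row (P * adj_mat G ws)" "j < dim_col (P * adj_mat G ws)"
    then have ij: "i < n" "j < n" by (auto simp: P_def adj_mat_def lw)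
    have "(P * adj_mat G ws) $$ (i, j) = (\<Sum>k\<in>{0..<n}. (if vs ! i = ws ! k then 1 else 0) *
            (if (ws ! k, ws ! j) \<in> parcs G then 1 else 0))"
      using ij lw by (simp add: P_def adj_mat_def scalar_prod_def)
    also have "\<dots> = (if (vs ! i, ws ! j) \<in> parcs G then 1 else 0)"
      using sumw[OF mv(1)[OF ij(1)], of "\<lambda>y. if (y, ws ! j) \<in> parcs G then 1 else 0"] .
    also have "\<dots> = (\<Sum>k\<in>{0..<n}. (if ws ! j = vs ! k then 1 else 0) *
            (if (vs ! i, vs ! k) \<in> parcs G then 1 else 0))"
      using sumv[OF mv(2)[OF ij(2)], of "\<lambda>y. if (vs ! i, y) \<in> parcs G then 1 else 0"] by simp
    also have "\<dots> = (adj_mat G vs * P) $$ (i, j)"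
      using ij by (auto simp: P_def adj_mat_def scalar_prod_def n_def intro!: sum.cong)
    finally show "(adj_mat G vs * P) $$ (i, j) = (P * adj_mat G ws) $$ (i, j)" ..
  qed (auto simp: P_def adj_mat_def lw n_def)
  have carr: "adj_mat G vs \<in> carrier_mat n n" "adj_mat G ws \<in> carrier_mat n n"
    "P \<in> carrier_mat n n" "Q \<in> carrier_mat n n"
    by (auto simp: adj_mat_def P_def Q_def lw n_def)
  have "adj_mat G vs = P * adj_mat G ws * Q"
    using assoc_mult_mat[OF carr(1,3,4)] right_mult_one_mat[OF carr(1)] by (simp add: PQ flip: comm)
  then have "similar_mat (adj_mat G vs) (adj_mat G ws)"
    using carr PQ QP unfolding similar_mat_def similar_mat_wit_def Let_def
    by (intro exI[of _ P] exI[of _ Q]) auto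
  then show ?thesis by (rule char_poly_similar)
qed

lemma graph_spectrum_eq:
  assumes "distinct vs" "set vs = pverts G"
  shows "graph_spectrum G = proots (char_poly (adj_mat G vs))"
proof -
  define ws where "ws = (SOME vs. distinct vs \<and> set vs = pverts G)"
  have "distinct ws \<and> set ws = pverts G"
    unfolding ws_def by (rule someI[of _ vs]) (use assms in simp)
  then have "char_poly (adj_mat G ws) = char_poly (adj_mat G vs)"
    using assms by (intro char_poly_adj_mat_perm) auto
  then show ?thesis by (simp add: graph_spectrum_def ws_def)
qed

subsection \<open>Graph operations\<close>

definition kfold_graph :: "nat \<Rightarrow> 'a pair_pre_digraph \<Rightarrow> ('a \<times> nat) pair_pre_digraph" where
  "kfold_graph k G =
     \<lparr> pverts = pverts G \<times> {1..k},
       parcs = {((u, a), (v, b)) | u v a b. (u, v) \<in> parcs G \<and> a \<in> {1..k} \<and> b \<in> {1..k}} \<rparr>"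

definition kronecker ::
    "'a pair_pre_digraph \<Rightarrow> 'b pair_pre_digraph \<Rightarrow> ('a \<times> 'b) pair_pre_digraph" where
  "kronecker G H =
     \<lparr> pverts = pverts G \<times> pverts H,
       parcs = {((u1, v1), (u2, v2)) | u1 v1 u2 v2.
                  (u1, u2) \<in> parcs G \<and> (v1, v2) \<in> parcs H} \<rparr>"

definition K2 :: "nat pair_pre_digraph" where
  "K2 = \<lparr> pverts = {0, 1}, parcs = {(0, 1), (1, 0)} \<rparr>"

definition relabel :: "('a \<Rightarrow> 'b) \<Rightarrow> 'a pair_pre_digraph \<Rightarrow> 'b pair_pre_digraph" where
  "relabel f G = \<lparr> pverts = f ` pverts G, parcs = map_prod f f ` parcs G \<rparr>"

text \<open>
  If \<open>G\<close> has no edges, neither do its \<open>k\<close>-fold graphs and Kronecker products, and edgeless graphs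
  of equal order are cospectral; this is why the theorem assumes \<open>parcs G \<noteq> {}\<close>.
\<close>

text \<open>
  The vertex type of an iterated product would grow with the number of factors. The nested pair
  \<open>(\<dots>((v, b\<^sub>1), b\<^sub>2)\<dots>, b\<^sub>s)\<close> is therefore renamed to \<open>(v, [b\<^sub>s, \<dots>, b\<^sub>1])\<close>
  after each multiplication; both renamings below are injective.
\<close>

primrec kronecker_K2_iter :: "'a pair_pre_digraph \<Rightarrow> nat \<Rightarrow> ('a \<times> nat list) pair_pre_digraph"
where
  "kronecker_K2_iter G 0 = relabel (\<lambda>v. (v, [])) G"
| "kronecker_K2_iter G (Suc s) =
     relabel (\<lambda>((v, bs), b). (v, b # bs)) (kronecker (kronecker_K2_iter G s) K2)"

end

theory Submission
  imports Defs "Jordan_Normal_Form.Schur_Decomposition"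
begin

text \<open>
  Comparing numbers of vertices, \<open>n k\<close> against \<open>n 2\<^sup>s\<close> with \<open>n > 0\<close>, shows that equienergetic
  graphs force \<open>k = 2\<^sup>s\<close>. For this value of \<open>k\<close> both constructions arise by doubling \<open>s\<close> times:
  the vertices of \<open>D\<^sup>2\<^sup>k[G]\<close> form two copies of those of \<open>D\<^sup>k[G]\<close>, and the vertices of a product with
  \<open>K\<^sub>2\<close> form two copies of those of the other factor. If \<open>A\<close> is the adjacency matrix
  before a doubling, the one after it is the block matrix
  \<open>[[x A, y A], [y A, x A]]\<close>, with \<open>x = y = 1\<close> for the \<open>k\<close>-fold graph and \<open>x = 0\<close>, \<open>y = 1\<close> for the
  Kronecker product. Its spectrum consists of the numbers \<open>(x + y) \<lambda>\<close> and \<open>(x - y) \<lambda>\<close> for the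
  eigenvalues \<open>\<lambda>\<close> of \<open>A\<close> (\<open>graph_spectrum_two_copies\<close>). So each \<open>\<lambda>\<close> is replaced by \<open>2 \<lambda>\<close> and \<open>0\<close> in
  the first case, by \<open>\<lambda>\<close> and \<open>- \<lambda>\<close> in the second.

  Both replacements double the sum of the moduli, so the two energies agree. The spectra are told
  apart by the sum of the squares, which grows by the factor 4 in the first case and only by the factor 2
  in the second. For \<open>G\<close> itself this sum is the trace of \<open>A\<^sup>2\<close>, which counts the arcs
  (\<open>sum_squares_graph_spectrum\<close>) and hence is nonzero; since \<open>4\<^sup>s \<noteq> 2\<^sup>s\<close> for \<open>s \<ge> 1\<close>, the spectra
  differ.
\<close>

section \<open>Eigenvalues of complex matrices\<close>

lemma proots_prod_linear_factors:
  "proots (\<Prod>a\<leftarrow>as. [:- a, 1:]) = mset (as :: 'a :: idom list)"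
proof (induction as)
  case (Cons a as)
  have "(\<Prod>a\<leftarrow>as. [:- a, 1:]) \<noteq> 0"
    by (auto simp: prod_list_zero_iff)
  then show ?case
    using Cons.IH by (simp add: proots_mult del: mult_pCons_left)
qed simp

text \<open>
  Schur's triangular form reduces statements about all eigenvalues with multiplicity, the roots of the
  characteristic polynomial, to statements about diagonal entries.
\<close>

lemma triangular_form_of_spectrum:
  fixes A :: "complex mat"
  assumes A: "A \<in> carrier_mat n n"
  obtains B P Q where "similar_mat_wit A B P Q" "upper_triangular B"
    "mset (diag_mat B) = proots (char_poly A)"
proof -
  obtain as where as: "char_poly A = (\<Prod>a\<leftarrow>as. [:- a, 1:])"
    using char_poly_factorized[OF A] by blast
  obtain B P Q where "schur_decomposition A as = (B, P, Q)"
    by (cases "schur_decomposition A as") auto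
  with schur_decomposition[OF A as this] show thesis
    by (intro that[of B P Q]) (auto simp: as proots_prod_linear_factors)
qed

text \<open>
  A similarity \<open>A = P B Q\<close> is also one between \<open>c A\<close> and \<open>c B\<close>, and \<open>c B\<close> is still triangular. This
  argument includes \<open>c = 0\<close>, which occurs when a \<open>k\<close>-fold graph is doubled.
\<close>

lemma proots_char_poly_smult:
  fixes A :: "complex mat"
  assumes A: "A \<in> carrier_mat n n"
  shows "proots (char_poly (c \<cdot>\<^sub>m A)) = image_mset ((*) c) (proots (char_poly A))"
proof -
  obtain B P Q where B: "similar_mat_wit A B P Q" "upper_triangular B"
    "mset (diag_mat B) = proots (char_poly A)"
    using triangular_form_of_spectrum[OF A] .
  have dB: "B \<in> carrier_mat n n"
    using similar_mat_witD2[OF A B(1)] by simp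
  have "similar_mat (c \<cdot>\<^sub>m A) (c \<cdot>\<^sub>m B)"
    using B(1) by (intro similar_mat_smult) (auto simp: similar_mat_def)
  moreover have "upper_triangular (c \<cdot>\<^sub>m B)"
    using B(2) dB by (auto simp: upper_triangular_def)
  ultimately have "char_poly (c \<cdot>\<^sub>m A) = (\<Prod>a\<leftarrow>diag_mat (c \<cdot>\<^sub>m B). [:- a, 1:])"
    using dB char_poly_upper_triangular[of "c \<cdot>\<^sub>m B" n] by (simp add: char_poly_similar)
  moreover have "diag_mat (c \<cdot>\<^sub>m B) = map ((*) c) (diag_mat B)"
    using dB by (auto simp: diag_mat_def)
  ultimately show ?thesis
    by (simp add: proots_prod_linear_factors del: map_map flip: B(3))
qed

lemma trace_mult_commute:
  fixes X Y :: "'a :: comm_ring_1 mat"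
  assumes "X \<in> carrier_mat n n" "Y \<in> carrier_mat n n"
  shows "(\<Sum>i<n. (X * Y) $$ (i, i)) = (\<Sum>i<n. (Y * X) $$ (i, i))"
proof -
  have XY: "(\<Sum>i<n. (U * V) $$ (i, i)) = (\<Sum>i<n. \<Sum>j<n. U $$ (i, j) * V $$ (j, i))"
    if "U \<in> carrier_mat n n" "V \<in> carrier_mat n n" for U V :: "'a mat"
    using that by (intro sum.cong) (auto simp: scalar_prod_def lessThan_atLeast0)
  show ?thesis
    unfolding XY[OF assms] XY[OF assms(2,1)]
    by (subst sum.swap) (simp add: mult.commute)
qed

text \<open>
  The trace of \<open>A\<^sup>2\<close> is invariant under similarity, and for a triangular matrix the diagonal of the
  square consists of the squares of the diagonal entries.
\<close>

lemma sum_squares_eigenvalues: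
  fixes A :: "complex mat"
  assumes A: "A \<in> carrier_mat n n"
  shows "(\<Sum>x\<in>#proots (char_poly A). x\<^sup>2) = (\<Sum>i<n. (A * A) $$ (i, i))"
proof -
  obtain B P Q where B: "similar_mat_wit A B P Q" "upper_triangular B"
    "mset (diag_mat B) = proots (char_poly A)"
    using triangular_form_of_spectrum[OF A] .
  note w = similar_mat_witD2[OF A B(1)]
  have "A * A = P * (B * B * Q)"
  proof -
    have "A * A = P * B * Q * (P * B * Q)"
      using w(3) by simp
    also have "\<dots> = P * (B * ((Q * P) * (B * Q)))"
      using w(4-7) by (simp add: assoc_mult_mat[of _ n n _ n _ n])
    also have "\<dots> = P * (B * B * Q)"
      using w(2,4-7) by (simp add: assoc_mult_mat[of _ n n _ n _ n])
    finally show ?thesis .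
  qed
  then have "(\<Sum>i<n. (A * A) $$ (i, i)) = (\<Sum>i<n. (B * B * Q * P) $$ (i, i))"
    using trace_mult_commute[of P n "B * B * Q"] w by simp
  also have "B * B * Q * P = B * B"
    using w by (simp add: assoc_mult_mat[of _ n n _ n _ n])
  also have "(\<Sum>i<n. (B * B) $$ (i, i)) = (\<Sum>i<n. (B $$ (i, i))\<^sup>2)"
  proof (rule sum.cong[OF refl])
    fix i assume i: "i \<in> {..<n}"
    have "(B * B) $$ (i, i) = (\<Sum>j<n. B $$ (i, j) * B $$ (j, i))"
      using i w(5) by (auto simp: scalar_prod_def lessThan_atLeast0)
    also have "\<dots> = (\<Sum>j<n. if j = i then (B $$ (i, i))\<^sup>2 else 0)"
    proof (rule sum.cong[OF refl])
      fix j assume j: "j \<in> {..<n}"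
      show "B $$ (i, j) * B $$ (j, i) = (if j = i then (B $$ (i, i))\<^sup>2 else 0)"
        using i j w(5) upper_triangularD[OF B(2), of i j] upper_triangularD[OF B(2), of j i]
        by (cases i j rule: linorder_cases) (auto simp: power2_eq_square)
    qed
    finally show "(B * B) $$ (i, i) = (B $$ (i, i))\<^sup>2"
      using i by simp
  qed
  also have "\<dots> = sum_list (map (\<lambda>x. x\<^sup>2) (diag_mat B))"
    using w(5) by (simp add: diag_mat_def comp_def interv_sum_list_conv_sum_set_nat lessThan_atLeast0)
  also have "\<dots> = (\<Sum>x\<in>#proots (char_poly A). x\<^sup>2)"
    by (simp flip: B(3) sum_mset_sum_list mset_map)
  finally show ?thesis ..
qed

text \<open>
  Adding the second block column to the first and subtracting the first block row from the second
  is a similarity, which makes the matrix block triangular with diagonal blocks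
  \<open>(x + y) A\<close> and \<open>(x - y) A\<close>.
\<close>

lemma char_poly_two_copies:
  fixes A :: "complex mat"
  assumes A: "A \<in> carrier_mat n n"
  shows "char_poly (four_block_mat (x \<cdot>\<^sub>m A) (y \<cdot>\<^sub>m A) (y \<cdot>\<^sub>m A) (x \<cdot>\<^sub>m A)) =
         char_poly ((x + y) \<cdot>\<^sub>m A) * char_poly ((x - y) \<cdot>\<^sub>m A)"
proof -
  let ?I = "1\<^sub>m n :: complex mat" and ?O = "0\<^sub>m n n :: complex mat"
  let ?M = "four_block_mat (x \<cdot>\<^sub>m A) (y \<cdot>\<^sub>m A) (y \<cdot>\<^sub>m A) (x \<cdot>\<^sub>m A)"
  let ?T = "four_block_mat ((x + y) \<cdot>\<^sub>m A) (y \<cdot>\<^sub>m A) ?O ((x - y) \<cdot>\<^sub>m A)"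
  let ?P = "four_block_mat ?I ?O ?I ?I" and ?Q = "four_block_mat ?I ?O (- ?I) ?I"
  have neg: "- ?I + ?I = ?O" "?I + - ?I = ?O" "?I + - ?O = ?I"
    by (auto intro!: eq_matI)
  have PQ: "?P * ?Q = 1\<^sub>m (n + n)"
    by (subst mult_four_block_mat[of _ n n _ n _ n _ _ n _ n]) (auto simp: neg)
  have QP: "?Q * ?P = 1\<^sub>m (n + n)"
    by (subst mult_four_block_mat[of _ n n _ n _ n _ _ n _ n]) (auto simp: neg)
  have PT: "?P * ?T = four_block_mat ((x + y) \<cdot>\<^sub>m A) (y \<cdot>\<^sub>m A) ((x + y) \<cdot>\<^sub>m A) (x \<cdot>\<^sub>m A)"
    using A
    by (subst mult_four_block_mat[of _ n n _ n _ n _ _ n _ n])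
       (auto intro!: cong_four_block_mat eq_matI simp: algebra_simps)
  have neg_mult: "X * - ?I = - X" if "X \<in> carrier_mat n n" for X
    using that by simp
  have "?P * ?T * ?Q = ?M"
    unfolding PT using A
    by (subst mult_four_block_mat[of _ n n _ n _ n _ _ n _ n])
       (auto intro!: cong_four_block_mat eq_matI simp: neg_mult algebra_simps)
  then have "similar_mat ?M ?T"
    using A PQ QP by (intro similar_matI[of _ _ ?P ?Q "n + n"]) auto
  then have "char_poly ?M = char_poly ?T"
    by (rule char_poly_similar)
  also have "\<dots> = char_poly ((x + y) \<cdot>\<^sub>m A) * char_poly ((x - y) \<cdot>\<^sub>m A)"
    using A char_poly_factorized[of "(x + y) \<cdot>\<^sub>m A" n] char_poly_factorized[of "(x - y) \<cdot>\<^sub>m A" n]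
    by (intro char_poly_0_block[OF refl]) auto
  finally show ?thesis .
qed

section \<open>Graph spectra\<close>

lemma adj_mat_carrier [simp]: "adj_mat G vs \<in> carrier_mat (length vs) (length vs)"
  by (simp add: adj_mat_def)

lemma graph_spectrum_image:
  assumes "finite (pverts G)" "inj_on f (pverts G)" "pverts H = f ` pverts G"
    and "\<And>u v. u \<in> pverts G \<Longrightarrow> v \<in> pverts G \<Longrightarrow> (f u, f v) \<in> parcs H \<longleftrightarrow> (u, v) \<in> parcs G"
  shows "graph_spectrum H = graph_spectrum G"
proof -
  obtain vs where vs: "distinct vs" "set vs = pverts G"
    using finite_distinct_list[OF assms(1)] by blast
  have nth: "vs ! i \<in> pverts G" if "i < length vs" for i
    using that vs(2) nth_mem by blast
  have "adj_mat H (map f vs) = adj_mat G vs"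
    by (rule eq_matI) (auto simp: adj_mat_def assms(4) nth)
  moreover have "graph_spectrum H = proots (char_poly (adj_mat H (map f vs)))"
    using vs assms by (intro graph_spectrum_eq) (auto simp: distinct_map)
  ultimately show ?thesis
    by (simp add: graph_spectrum_eq[OF vs])
qed

text \<open>
  The two copies are the images of \<open>f False\<close> and \<open>f True\<close>. The weights \<open>x\<close> and \<open>y\<close>, each 0 or 1 in the
  applications, tell whether the arcs of \<open>G\<close> are reproduced within a copy and between the copies.
  Listing one copy after the other gives the adjacency matrix of \<open>H\<close> the required block form.
\<close>

lemma graph_spectrum_two_copies:
  fixes f :: "bool \<Rightarrow> 'a \<Rightarrow> 'b" and x y :: complex
  assumes fin: "finite (pverts G)" and inj: "\<And>i. inj_on (f i) (pverts G)"
    and disj: "f False ` pverts G \<inter> f True ` pverts G = {}"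
    and verts: "pverts H = f False ` pverts G \<union> f True ` pverts G"
    and arcs: "\<And>i j u v. u \<in> pverts G \<Longrightarrow> v \<in> pverts G \<Longrightarrow>
      (if (f i u, f j v) \<in> parcs H then 1 else 0) =
      (if i = j then x else y) * (if (u, v) \<in> parcs G then 1 else 0)"
  shows "graph_spectrum H = image_mset ((*) (x + y)) (graph_spectrum G) +
                            image_mset ((*) (x - y)) (graph_spectrum G)"
proof -
  obtain vs where vs: "distinct vs" "set vs = pverts G"
    using finite_distinct_list[OF fin] by blast
  define n where "n = length vs"
  define A where "A = adj_mat G vs"
  have A: "A \<in> carrier_mat n n"
    by (simp add: A_def n_def)
  have nth: "vs ! i \<in> pverts G" if "i < n" for i
    using that vs(2) nth_mem unfolding n_def by blast
  let ?ws = "map (f False) vs @ map (f True) vs"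
  have ws: "?ws ! i = f (i \<ge> n) (vs ! (if i < n then i else i - n))" if "i < n + n" for i
    using that by (auto simp: nth_append n_def)
  have "adj_mat H ?ws = four_block_mat (x \<cdot>\<^sub>m A) (y \<cdot>\<^sub>m A) (y \<cdot>\<^sub>m A) (x \<cdot>\<^sub>m A)" (is "_ = ?M")
  proof (rule eq_matI)
    fix i j assume "i < dim_row ?M" "j < dim_col ?M"
    then have ij: "i < n + n" "j < n + n"
      using A by auto
    let ?r = "\<lambda>i. if i < n then i else i - n"
    have r: "?r i < n" "?r j < n"
      using ij by auto
    have "adj_mat H ?ws $$ (i, j) = (if (?ws ! i, ?ws ! j) \<in> parcs H then 1 else 0)"
      using ij by (simp add: adj_mat_def n_def)
    also have "\<dots> = (if (i \<ge> n) = (j \<ge> n) then x else y) * A $$ (?r i, ?r j)"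
      unfolding ws[OF ij(1)] ws[OF ij(2)] arcs[OF nth[OF r(1)] nth[OF r(2)]]
      using r by (simp only: A_def adj_mat_def n_def index_mat prod.case)
    also have "\<dots> = ?M $$ (i, j)"
      using ij A by auto
    finally show "adj_mat H ?ws $$ (i, j) = ?M $$ (i, j)" .
  qed (use A in \<open>auto simp: adj_mat_def n_def\<close>)
  moreover have "graph_spectrum H = proots (char_poly (adj_mat H ?ws))"
    using vs inj disj verts by (intro graph_spectrum_eq) (auto simp: distinct_map)
  moreover have "char_poly ((x + y) \<cdot>\<^sub>m A) \<noteq> 0" "char_poly ((x - y) \<cdot>\<^sub>m A) \<noteq> 0"
    using A degree_monic_char_poly[of "(x + y) \<cdot>\<^sub>m A" n]
      degree_monic_char_poly[of "(x - y) \<cdot>\<^sub>m A" n] by auto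
  ultimately have "graph_spectrum H =
      proots (char_poly ((x + y) \<cdot>\<^sub>m A)) + proots (char_poly ((x - y) \<cdot>\<^sub>m A))"
    by (simp add: char_poly_two_copies[OF A] proots_mult)
  then show ?thesis
    by (simp add: proots_char_poly_smult[OF A] graph_spectrum_eq[OF vs] flip: A_def)
qed

text \<open>
  By symmetry the trace of \<open>A\<^sup>2\<close> is the sum of the squares of the entries of \<open>A\<close>, which are 0 or 1.
\<close>

lemma sum_squares_graph_spectrum:
  assumes "pair_graph G"
  shows "(\<Sum>x\<in>#graph_spectrum G. x\<^sup>2) = of_nat (card (parcs G))"
proof -
  interpret pair_graph G by fact
  obtain vs where vs: "distinct vs" "set vs = pverts G"
    using finite_distinct_list[OF pair_finite_verts] by blast
  define n where "n = length vs"
  define A where "A = adj_mat G vs"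
  have A: "A \<in> carrier_mat n n"
    by (simp add: A_def n_def)
  have bij: "bij_betw ((!) vs) {..<n} (pverts G)"
    unfolding n_def using bij_betw_nth[OF vs(1) refl] vs(2) by simp
  have sym: "(u, v) \<in> parcs G \<longleftrightarrow> (v, u) \<in> parcs G" for u v
    by (meson arcs_symmetric)
  have arcs: "parcs G = {p \<in> pverts G \<times> pverts G. p \<in> parcs G}"
    using arc_fst_in_verts arc_snd_in_verts by force
  have "(\<Sum>x\<in>#graph_spectrum G. x\<^sup>2) = (\<Sum>i<n. (A * A) $$ (i, i))"
    by (simp add: graph_spectrum_eq[OF vs] sum_squares_eigenvalues[OF A] flip: A_def)
  also have "\<dots> = (\<Sum>i<n. \<Sum>j<n. if (vs ! i, vs ! j) \<in> parcs G then 1 else 0)"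
  proof (rule sum.cong[OF refl])
    fix i assume i: "i \<in> {..<n}"
    have "(A * A) $$ (i, i) = (\<Sum>j<n. A $$ (i, j) * A $$ (j, i))"
      using i A by (auto simp: scalar_prod_def lessThan_atLeast0)
    also have "\<dots> = (\<Sum>j<n. if (vs ! i, vs ! j) \<in> parcs G then 1 else 0)"
      using i sym by (intro sum.cong) (auto simp: A_def adj_mat_def n_def)
    finally show "(A * A) $$ (i, i) = \<dots>" .
  qed
  also have "\<dots> = (\<Sum>u\<in>pverts G. \<Sum>v\<in>pverts G. if (u, v) \<in> parcs G then 1 else 0)"
    by (simp add: sum.reindex_bij_betw[OF bij, of "\<lambda>v. if (_, v) \<in> parcs G then 1 else 0"]
        sum.reindex_bij_betw[OF bij,
          of "\<lambda>u. \<Sum>v\<in>pverts G. if (u, v) \<in> parcs G then 1 else 0"])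
  also have "\<dots> = (\<Sum>p\<in>pverts G \<times> pverts G. if p \<in> parcs G then 1 else 0)"
    by (simp add: sum.cartesian_product)
  also have "\<dots> = of_nat (card {p \<in> pverts G \<times> pverts G. p \<in> parcs G})"
    using pair_finite_verts by (simp add: sum.If_cases Int_def)
  finally show ?thesis
    by (simp flip: arcs)
qed

section \<open>The two constructions as iterated doublings\<close>

lemma finite_pverts_kfold [simp]: "finite (pverts G) \<Longrightarrow> finite (pverts (kfold_graph k G))"
  by (simp add: kfold_graph_def)

lemma pverts_kronecker_K2_iter:
  "pverts (kronecker_K2_iter G s) = pverts G \<times> {bs. length bs = s \<and> set bs \<subseteq> {0, 1}}"
proof (induction s)
  case 0
  then show ?case by (auto simp: relabel_def)
next
  case (Suc s)
  have "pverts (kronecker_K2_iter G (Suc s)) =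
      (\<lambda>((v, bs), b). (v, b # bs)) `
        ((pverts G \<times> {bs. length bs = s \<and> set bs \<subseteq> {0, 1}}) \<times> {0, 1})"
    by (simp add: relabel_def kronecker_def K2_def Suc.IH)
  also have "\<dots> = pverts G \<times> {bs. length bs = Suc s \<and> set bs \<subseteq> {0, 1}}"
    by (force simp: length_Suc_conv image_iff)
  finally show ?case .
qed

lemma finite_pverts_kronecker_K2_iter [simp]:
  "finite (pverts G) \<Longrightarrow> finite (pverts (kronecker_K2_iter G s))"
  unfolding pverts_kronecker_K2_iter
  using finite_lists_length_eq[of "{0, 1 :: nat}" s] by (simp add: conj_commute)

lemma card_pverts_kronecker_K2_iter:
  "card (pverts (kronecker_K2_iter G s)) = card (pverts G) * 2 ^ s"
  unfolding pverts_kronecker_K2_iter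
  using card_lists_length_eq[of "{0, 1 :: nat}" s]
  by (simp add: card_cartesian_product conj_commute numeral_2_eq_2)

lemma graph_spectrum_kfold_1:
  assumes "finite (pverts G)"
  shows "graph_spectrum (kfold_graph 1 G) = graph_spectrum G"
  using assms
  by (intro graph_spectrum_image[where f = "\<lambda>v. (v, 1)"]) (auto simp: kfold_graph_def inj_on_def)

text \<open>
  The second copy of \<open>D\<^sup>k[G]\<close> has its layer numbers shifted by \<open>k\<close>. Adjacency ignores the layers, so
  arcs are reproduced within and between the copies alike.
\<close>

lemma graph_spectrum_kfold_double:
  assumes "finite (pverts G)"
  shows "graph_spectrum (kfold_graph (2 * k) G) =
         image_mset ((*) 2) (graph_spectrum (kfold_graph k G)) +
         image_mset ((*) 0) (graph_spectrum (kfold_graph k G))"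
proof -
  define f :: "bool \<Rightarrow> 'a \<times> nat \<Rightarrow> 'a \<times> nat"
    where "f i = (\<lambda>(v, a). (v, if i then a + k else a))" for i
  have im: "f False ` pverts (kfold_graph k G) = pverts G \<times> {1..k}"
    by (auto simp: f_def kfold_graph_def)
  have "(\<lambda>(v, a). (v, a + k)) ` (V \<times> {1..k}) = V \<times> {k + 1..2 * k}" for V :: "'a set"
  proof (intro equalityI subsetI)
    fix p assume "p \<in> V \<times> {k + 1..2 * k}"
    then have "(fst p, snd p - k) \<in> V \<times> {1..k}" "p = (fst p, snd p - k + k)"
      by auto
    then show "p \<in> (\<lambda>(v, a). (v, a + k)) ` (V \<times> {1..k})"
      by (metis (mono_tags, lifting) case_prod_conv image_eqI)
  qed auto
  then have im': "f True ` pverts (kfold_graph k G) = pverts G \<times> {k + 1..2 * k}"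
    by (simp add: f_def kfold_graph_def)
  have "graph_spectrum (kfold_graph (2 * k) G) =
      image_mset ((*) (1 + 1)) (graph_spectrum (kfold_graph k G)) +
      image_mset ((*) (1 - 1)) (graph_spectrum (kfold_graph k G))"
  proof (rule graph_spectrum_two_copies[where f = f])
    show "inj_on (f i) (pverts (kfold_graph k G))" for i
      by (auto simp: f_def inj_on_def split: if_splits)
    show "f False ` pverts (kfold_graph k G) \<inter> f True ` pverts (kfold_graph k G) = {}"
      unfolding im im' by auto
    show "pverts (kfold_graph (2 * k) G) =
        f False ` pverts (kfold_graph k G) \<union> f True ` pverts (kfold_graph k G)"
      unfolding im im' by (auto simp: kfold_graph_def)
  qed (use assms in \<open>auto simp: f_def kfold_graph_def split: if_splits\<close>)
  then show ?thesis by simp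
qed

lemma graph_spectrum_kronecker_K2_iter_0:
  assumes "finite (pverts G)"
  shows "graph_spectrum (kronecker_K2_iter G 0) = graph_spectrum G"
  using assms
  by (intro graph_spectrum_image[where f = "\<lambda>v. (v, [])"]) (auto simp: relabel_def inj_on_def)

text \<open>
  The two copies are given by the \<open>K\<^sub>2\<close>-coordinate, which changes along every arc of the product.
\<close>

lemma graph_spectrum_kronecker_K2_iter_Suc:
  assumes "finite (pverts G)"
  shows "graph_spectrum (kronecker_K2_iter G (Suc s)) =
         graph_spectrum (kronecker_K2_iter G s) +
         image_mset uminus (graph_spectrum (kronecker_K2_iter G s))"
proof -
  let ?H = "kronecker_K2_iter G s"
  define f :: "bool \<Rightarrow> 'a \<times> nat list \<Rightarrow> 'a \<times> nat list"
    where "f i = (\<lambda>(v, bs). (v, of_bool i # bs))" for i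
  have "graph_spectrum (kronecker_K2_iter G (Suc s)) =
      image_mset ((*) (0 + 1)) (graph_spectrum ?H) + image_mset ((*) (0 - 1)) (graph_spectrum ?H)"
  proof (rule graph_spectrum_two_copies[where f = f])
    show "finite (pverts ?H)"
      using assms by simp
    show "inj_on (f i) (pverts ?H)" for i
      by (auto simp: f_def inj_on_def)
    show "f False ` pverts ?H \<inter> f True ` pverts ?H = {}"
      by (auto simp: f_def)
    show "pverts (kronecker_K2_iter G (Suc s)) = f False ` pverts ?H \<union> f True ` pverts ?H"
      by (force simp: relabel_def kronecker_def K2_def f_def)
    fix i j u v
    have "(f i u, f j v) \<in> parcs (kronecker_K2_iter G (Suc s)) \<longleftrightarrow> i \<noteq> j \<and> (u, v) \<in> parcs ?H"
      by (cases u; cases v; cases i; cases j)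
         (force simp: relabel_def kronecker_def K2_def f_def image_iff)+
    then show "(if (f i u, f j v) \<in> parcs (kronecker_K2_iter G (Suc s)) then 1 else 0) =
        (if i = j then 0 else 1) * (if (u, v) \<in> parcs ?H then 1 else 0 :: complex)"
      by simp
  qed
  moreover have "(*) 1 = (\<lambda>x :: complex. x)" "(*) (- 1) = (uminus :: complex \<Rightarrow> complex)"
    by auto
  ultimately show ?thesis by simp
qed

text \<open>
  In the inductions on the energy and on the sum of squares, constant factors have to stay outside
  the sums over the spectrum; the deleted simplification rule moves them inside.
\<close>

lemma energy_kfold:
  assumes "finite (pverts G)"
  shows "energy (kfold_graph (2 ^ s) G) = 2 ^ s * energy G"
proof (induction s)
  case 0
  show ?case
    using graph_spectrum_kfold_1[OF assms] by (simp add: energy_def)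
next
  case (Suc s)
  then show ?case
    by (simp add: energy_def graph_spectrum_kfold_double[OF assms] multiset.map_comp comp_def
        norm_mult sum_mset_distrib_left[symmetric]
        del: mult_hom.hom_sum_mset)
qed

lemma energy_kronecker_K2_iter:
  assumes "finite (pverts G)"
  shows "energy (kronecker_K2_iter G s) = 2 ^ s * energy G"
proof (induction s)
  case 0
  show ?case
    using graph_spectrum_kronecker_K2_iter_0[OF assms] by (simp add: energy_def)
next
  case (Suc s)
  then show ?case
    by (simp add: energy_def graph_spectrum_kronecker_K2_iter_Suc[OF assms] multiset.map_comp comp_def
        del: kronecker_K2_iter.simps mult_hom.hom_sum_mset)
qed

lemma sum_squares_kfold:
  assumes "finite (pverts G)"
  shows "(\<Sum>x\<in>#graph_spectrum (kfold_graph (2 ^ s) G). x\<^sup>2) = 4 ^ s * (\<Sum>x\<in>#graph_spectrum G. x\<^sup>2)"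
proof (induction s)
  case 0
  show ?case
    using graph_spectrum_kfold_1[OF assms] by simp
next
  case (Suc s)
  then show ?case
    by (simp add: graph_spectrum_kfold_double[OF assms] multiset.map_comp comp_def
        power_mult_distrib sum_mset_distrib_left[symmetric]
        del: mult_hom.hom_sum_mset)
qed

lemma sum_squares_kronecker_K2_iter:
  assumes "finite (pverts G)"
  shows "(\<Sum>x\<in>#graph_spectrum (kronecker_K2_iter G s). x\<^sup>2) = 2 ^ s * (\<Sum>x\<in>#graph_spectrum G. x\<^sup>2)"
proof (induction s)
  case 0
  show ?case
    using graph_spectrum_kronecker_K2_iter_0[OF assms] by simp
next
  case (Suc s)
  then show ?case
    by (simp add: graph_spectrum_kronecker_K2_iter_Suc[OF assms] multiset.map_comp comp_def
        del: kronecker_K2_iter.simps mult_hom.hom_sum_mset)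
qed

theorem theorem2p7:
  fixes G :: "'a pair_pre_digraph" and k s :: nat
  assumes "pair_graph G"
    and "parcs G \<noteq> {}"
    and "k \<ge> 1" and "s \<ge> 1"
  shows "non_cospectral (kfold_graph k G) (kronecker_K2_iter G s) \<and>
         equienergetic (kfold_graph k G) (kronecker_K2_iter G s) \<longleftrightarrow> k = 2 ^ s"
proof -
  interpret pair_graph G by fact
  note fin = pair_finite_verts
  have "pverts G \<noteq> {}"
    using assms(2) arc_fst_in_verts by force
  then have V: "card (pverts G) > 0"
    using fin by (simp add: card_gt_0_iff)
  have card_kfold: "card (pverts (kfold_graph k G)) = card (pverts G) * k"
    by (simp add: kfold_graph_def card_cartesian_product)
  have equi: "equienergetic (kfold_graph k G) (kronecker_K2_iter G s) \<longleftrightarrow> k = 2 ^ s"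
    using V by (auto simp: equienergetic_def card_kfold card_pverts_kronecker_K2_iter
        energy_kfold[OF fin] energy_kronecker_K2_iter[OF fin])
  have "graph_spectrum (kfold_graph (2 ^ s) G) \<noteq> graph_spectrum (kronecker_K2_iter G s)"
  proof
    assume "graph_spectrum (kfold_graph (2 ^ s) G) = graph_spectrum (kronecker_K2_iter G s)"
    then have "4 ^ s * (\<Sum>x\<in>#graph_spectrum G. x\<^sup>2) = 2 ^ s * (\<Sum>x\<in>#graph_spectrum G. x\<^sup>2)"
      by (metis sum_squares_kfold[OF fin] sum_squares_kronecker_K2_iter[OF fin])
    then have "(4 :: complex) ^ s = 2 ^ s"
      using assms(2) pair_finite_arcs by (simp add: sum_squares_graph_spectrum[OF assms(1)])
    then have "(of_nat (4 ^ s) :: complex) = of_nat (2 ^ s)"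
      by simp
    then have "(4 :: nat) ^ s = 2 ^ s"
      by (simp only: of_nat_eq_iff)
    moreover have "(2 :: nat) ^ s < 4 ^ s"
      using assms(4) by (intro power_strict_mono) auto
    ultimately show False by simp
  qed
  then show ?thesis
    using equi by (auto simp: non_cospectral_def)
qed

end
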